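(* Let $\mathfrak{L}$ be a finite-dimensional left Leibniz algebra over an algebraically closed field $\mathbb{F}$. Then $\mathfrak{L}$ is supersolvable if, and only if, $\mathfrak{L}$ is solvable and all maximal chains of subalgebras of $\mathfrak{L}$ have the same length.
   Context: A left Leibniz algebra over a field $\mathbb{F}$ is an $\mathbb{F}$-vector space $\mathfrak{L}$ with a bilinear multiplication satisfying $x(yz)=(xy)z+y(xz)$ for all $x,y,z\in\mathfrak{L}$. Ideals are two-sided. $\mathfrak{L}$ is supersolvable if there is a chain $\mathfrak{L}=\mathfrak{L}_k\supset\mathfrak{L}_{k-1}\supset\cdots\supset\mathfrak{L}_1\supset\mathfrak{L}_0=0$ of ideals of $\mathfrak{L}$ with $\dim_{\mathbb{F}}\mathfrak{L}_j/\mathfrak{L}_{j-1}=1$ for $1\le j\le k$. $\mathfrak{L}$ is solvable if its derived series $\mathfrak{L}^{(0)}=\mathfrak{L}$, $\mathfrak{L}^{(i+1)}=\langle xy\mid x,y\in\mathfrak{L}^{(i)}\rangle_{\mathbb{F}}$ reaches $0$. A maximal chain of subalgebras is a chain $\mathfrak{L}=\mathfrak{M}_r\supset\mathfrak{M}_{r-1}\supset\cdots\supset\mathfrak{M}_0=0$ of subalgebras in which each $\mathfrak{M}_{j-1}$ is a maximal subalgebra of $\mathfrak{M}_j$; its length is $r$. *)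

theory Defs
  imports "HOL-Computational_Algebra.Polynomial"
begin

(* The algebra is the whole type 'b. *)
locale left_leibniz_algebra = vector_space scale
  for scale :: "'a::field \<Rightarrow> 'b::ab_group_add \<Rightarrow> 'b" +
  fixes mult :: "'b \<Rightarrow> 'b \<Rightarrow> 'b" (infixl \<open>\<bullet>\<close> 70)
  assumes linear_right: "Vector_Spaces.linear scale scale (\<lambda>y. x \<bullet> y)"
    and linear_left: "Vector_Spaces.linear scale scale (\<lambda>x. x \<bullet> y)"
    and leibniz: "x \<bullet> (y \<bullet> z) = (x \<bullet> y) \<bullet> z + y \<bullet> (x \<bullet> z)"
begin

definition finite_dimensional :: bool where
  "finite_dimensional \<longleftrightarrow> (\<exists>B. finite B \<and> span B = UNIV)"

(* B is a set of representatives of a basis of the quotient space U / W: the cosets b + W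
   (b in B) are linearly independent, hence pairwise distinct, and they span U / W. *)
definition quotient_basis :: "'b set \<Rightarrow> 'b set \<Rightarrow> 'b set \<Rightarrow> bool" where
  "quotient_basis U W B \<longleftrightarrow>
     B \<subseteq> U \<and>
     (\<forall>S c. finite S \<longrightarrow> S \<subseteq> B \<longrightarrow> (\<Sum>b\<in>S. scale (c b) b) \<in> W \<longrightarrow> (\<forall>b\<in>S. c b = 0)) \<and>
     (\<forall>u\<in>U. \<exists>v\<in>span B. u - v \<in> W)"

(* The dimension of U / W, meant for subspaces W of U; like the library's dim it is 0 if
   the quotient is infinite-dimensional. *)
definition quotient_dim :: "'b set \<Rightarrow> 'b set \<Rightarrow> nat" where
  "quotient_dim U W = card (SOME B. quotient_basis U W B)"

definition subalgebra :: "'b set \<Rightarrow> bool" where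
  "subalgebra M \<longleftrightarrow> subspace M \<and> (\<forall>x\<in>M. \<forall>y\<in>M. x \<bullet> y \<in> M)"

definition two_sided_ideal :: "'b set \<Rightarrow> bool" where
  "two_sided_ideal I \<longleftrightarrow> subspace I \<and> (\<forall>x\<in>I. \<forall>y. x \<bullet> y \<in> I \<and> y \<bullet> x \<in> I)"

definition supersolvable :: bool where
  "supersolvable \<longleftrightarrow>
     (\<exists>(k::nat) L. L k = UNIV \<and> L 0 = {0} \<and>
        (\<forall>j\<le>k. two_sided_ideal (L j)) \<and>
        (\<forall>j\<in>{1..k}. L (j - 1) \<subset> L j \<and> quotient_dim (L j) (L (j - 1)) = 1))"

primrec derived_series :: "nat \<Rightarrow> 'b set" where
  "derived_series 0 = UNIV"
| "derived_series (Suc i) = span {x \<bullet> y |x y. x \<in> derived_series i \<and> y \<in> derived_series i}"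

definition solvable :: bool where
  "solvable \<longleftrightarrow> (\<exists>i. derived_series i = {0})"

definition maximal_subalgebra :: "'b set \<Rightarrow> 'b set \<Rightarrow> bool" where
  "maximal_subalgebra N M \<longleftrightarrow>
     subalgebra N \<and> N \<subset> M \<and> \<not> (\<exists>K. subalgebra K \<and> N \<subset> K \<and> K \<subset> M)"

definition maximal_chain :: "nat \<Rightarrow> (nat \<Rightarrow> 'b set) \<Rightarrow> bool" where
  "maximal_chain r M \<longleftrightarrow>
     M r = UNIV \<and> M 0 = {0} \<and>
     (\<forall>j\<le>r. subalgebra (M j)) \<and>
     (\<forall>j\<in>{1..r}. maximal_subalgebra (M (j - 1)) (M j))"

end

end

(* In a supersolvable algebra every maximal subalgebra M of a subalgebra H has codimension 1:
   pick the first member of the flag whose intersection with H is not contained in M. Conversely,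
   a solvable algebra has a maximal chain whose length is the dimension, so equal lengths force
   every maximal subalgebra of a subalgebra to have codimension 1. A flag of ideals is then built
   upwards. Let J be minimal among the ideals properly containing I; it is abelian and
   left-irreducible modulo I. Let C be the left annihilator of J modulo I. If C is not everything,
   induction on the codimension gives an ideal C + F n above C. Left multiplication by n is
   injective on J / I, and its generalized null component L0 (modulo I) supplements C, hence acts
   irreducibly on J / I and is maximal in L0 + J. So J / I has dimension 1. *)
theory Submission
  imports Defs
begin

section \<open>Bilinear multiplication and dimensions of subspaces\<close>

locale finite_dimensional_leibniz_algebra =
  left_leibniz_algebra scale mult + finite_dimensional_vector_space scale Basis
  for scale :: "'a::field \<Rightarrow> 'b::ab_group_add \<Rightarrow> 'b"
    and mult :: "'b \<Rightarrow> 'b \<Rightarrow> 'b" (infixl \<open>\<bullet>\<close> 70)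
    and Basis :: "'b set"
begin

lemma
  shows mult_add_right: "x \<bullet> (y + z) = x \<bullet> y + x \<bullet> z"
    and mult_diff_right: "x \<bullet> (y - z) = x \<bullet> y - x \<bullet> z"
    and mult_zero_right [simp]: "x \<bullet> 0 = 0"
    and mult_scale_right: "x \<bullet> scale c y = scale c (x \<bullet> y)"
    and mult_add_left: "(x + y) \<bullet> z = x \<bullet> z + y \<bullet> z"
    and mult_diff_left: "(x - y) \<bullet> z = x \<bullet> z - y \<bullet> z"
    and mult_zero_left [simp]: "0 \<bullet> x = 0"
    and mult_scale_left: "scale c x \<bullet> y = scale c (x \<bullet> y)"
proof -
  interpret r: Vector_Spaces.linear scale scale "\<lambda>y. x \<bullet> y" for x by (rule linear_right)
  interpret l: Vector_Spaces.linear scale scale "\<lambda>x. x \<bullet> y" for y by (rule linear_left)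
  show "x \<bullet> (y + z) = x \<bullet> y + x \<bullet> z" "x \<bullet> (y - z) = x \<bullet> y - x \<bullet> z" "x \<bullet> 0 = 0"
    "x \<bullet> scale c y = scale c (x \<bullet> y)"
    by (rule r.add r.diff r.zero r.scale)+
  show "(x + y) \<bullet> z = x \<bullet> z + y \<bullet> z" "(x - y) \<bullet> z = x \<bullet> z - y \<bullet> z" "0 \<bullet> x = 0"
    "scale c x \<bullet> y = scale c (x \<bullet> y)"
    by (rule l.add l.diff l.zero l.scale)+
qed

text \<open>In the Leibniz identity with equal first arguments the two iterated products
  cancel.\<close>

lemma square_mult: "(x \<bullet> x) \<bullet> y = 0"
  using leibniz[of x x y] by simp

text \<open>Polarization of \<open>square_mult\<close>. It stands in for antisymmetry when right
  multiplications are compared with left ones.\<close>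

lemma symmetrized_mult: "(x \<bullet> y + y \<bullet> x) \<bullet> z = 0"
  using square_mult[of "x + y" z] square_mult[of x z] square_mult[of y z]
  by (simp add: mult_add_left mult_add_right add.commute)

lemma mult_mult_left: "(x \<bullet> y) \<bullet> z = x \<bullet> (y \<bullet> z) - y \<bullet> (x \<bullet> z)"
  using leibniz[of x y z] by (simp add: algebra_simps)

lemma span_subspace_eq [simp]: "subspace S \<Longrightarrow> span S = S"
  by (simp add: span_eq_iff)

lemma dim_less: "subspace S \<Longrightarrow> subspace T \<Longrightarrow> S \<subset> T \<Longrightarrow> dim S < dim T"
  using dim_psubset[of S T] by simp

lemma dim_span_insert: "subspace W \<Longrightarrow> v \<notin> W \<Longrightarrow> dim (span (insert v W)) = Suc (dim W)"
  by (simp add: dim_insert)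

lemma span_insert_eq_if_dim_le:
  assumes "subspace W" "subspace U" "W \<subseteq> U" "v \<in> U" "v \<notin> W" "dim U \<le> Suc (dim W)"
  shows "span (insert v W) = U"
proof (rule subspace_dim_equal)
  show "span (insert v W) \<subseteq> U" using assms by (intro span_minimal) auto
qed (use assms dim_span_insert in auto)

lemma in_span_insert_iff: "subspace W \<Longrightarrow> x \<in> span (insert v W) \<longleftrightarrow> (\<exists>k. x - scale k v \<in> W)"
  by (simp add: span_breakdown_eq)

section \<open>Quotient bases and the dimension of a quotient\<close>

lemma quotient_basis_exists:
  assumes W: "subspace W" and U: "subspace U" and "W \<subseteq> U"
  shows "\<exists>B. quotient_basis U W B"
proof -
  obtain BW where BW: "BW \<subseteq> W" "independent BW" "span BW = W"
    using basis_subspace_exists[OF W] by metis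
  obtain BU where BU: "BW \<subseteq> BU" "BU \<subseteq> U" "independent BU" "U \<subseteq> span BU"
    using maximal_independent_subset_extend[of BW U] BW \<open>W \<subseteq> U\<close> by (metis order_trans)
  \<comment> \<open>A basis of \<open>W\<close> is extended to one of \<open>U\<close>; the added
    vectors represent a basis of the quotient.\<close>
  have "quotient_basis U W (BU - BW)"
    unfolding quotient_basis_def
  proof (intro conjI allI impI ballI)
    show "BU - BW \<subseteq> U" using BU by auto
  next
    fix S c b
    assume S: "finite S" "S \<subseteq> BU - BW" "(\<Sum>b\<in>S. scale (c b) b) \<in> W" and b: "b \<in> S"
    show "c b = 0"
    proof (rule ccontr)
      assume c: "c b \<noteq> 0"
      have "(\<Sum>b\<in>S. scale (c b) b) \<in> span (BU - {b})"
        using S b BU BW span_mono[of BW "BU - {b}"] by auto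
      moreover have "(\<Sum>b\<in>S - {b}. scale (c b) b) \<in> span (BU - {b})"
        using S by (intro span_sum span_scale span_base) auto
      moreover have "scale (c b) b = (\<Sum>b\<in>S. scale (c b) b) - (\<Sum>b\<in>S - {b}. scale (c b) b)"
        using S b by (simp add: sum_diff1)
      ultimately have "scale (c b) b \<in> span (BU - {b})" by (simp add: span_diff)
      then have "b \<in> span (BU - {b})" using c
        by (metis scale_scale span_scale left_inverse scale_one)
      then show False using BU S b by (auto simp: dependent_def)
    qed
  next
    fix u assume "u \<in> U"
    then have "u \<in> span ((BU - BW) \<union> BW)" using BU by (auto simp: Un_absorb2)
    then obtain x y where "u = x + y" "x \<in> span (BU - BW)" "y \<in> W"
      unfolding span_Un using BW by auto
    then show "\<exists>v\<in>span (BU - BW). u - v \<in> W" by (intro bexI[of _ x]) auto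
  qed
  then show ?thesis by blast
qed

text \<open>\<open>quotient_dim\<close> selects a basis by \<open>SOME\<close>, so every choice must
  have the same size. Adding vectors of \<open>B\<close> to \<open>W\<close> one at a time raises
  the dimension by one each time.\<close>

lemma card_quotient_basis:
  assumes W: "subspace W" and U: "subspace U" and "W \<subseteq> U" and B: "quotient_basis U W B"
  shows "card B + dim W = dim U"
proof -
  have BU: "B \<subseteq> U" using B by (auto simp: quotient_basis_def)
  have *: "dim (S \<union> W) = card S + dim W" if "finite S" "S \<subseteq> B" for S
    using that
  proof (induction S)
    case (insert b S)
    have "b \<notin> span (S \<union> W)"
    proof
      assume "b \<in> span (S \<union> W)"
      then obtain s w where sw: "b = s + w" "s \<in> span S" "w \<in> W"
        unfolding span_Un using W by auto
      then obtain c where c: "s = (\<Sum>x\<in>S. scale (c x) x)"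
        using span_finite[OF \<open>finite S\<close>] by auto
      \<comment> \<open>Turns \<open>b = s + w\<close> into a combination over
        \<open>insert b S\<close> with value in \<open>W\<close> and coefficient 1 at
        \<open>b\<close>.\<close>
      define d where "d x = (if x = b then 1 else - c x)" for x
      have "(\<Sum>x\<in>S. scale (d x) x) = (\<Sum>x\<in>S. - scale (c x) x)"
        using insert.hyps by (intro sum.cong) (auto simp: d_def)
      then have "(\<Sum>x\<in>insert b S. scale (d x) x) = w"
        using insert.hyps sw c by (simp add: sum_negf) (simp add: d_def)
      moreover have "\<forall>S c. finite S \<longrightarrow> S \<subseteq> B \<longrightarrow> (\<Sum>b\<in>S. scale (c b) b) \<in> W \<longrightarrow> (\<forall>b\<in>S. c b = 0)"
        using B by (simp add: quotient_basis_def)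
      ultimately have "\<forall>x\<in>insert b S. d x = 0"
        using sw insert.prems insert.hyps(1) by (metis finite_insert)
      then show False by (simp add: d_def)
    qed
    then show ?case using insert by (simp add: dim_insert)
  qed simp
  \<comment> \<open>An infinite \<open>B\<close> would have \<open>card\<close> 0; it is excluded by
    a finite subset with more than \<open>dim U\<close> elements.\<close>
  have "finite B"
  proof (rule ccontr)
    assume "infinite B"
    then obtain S where "finite S" "card S = Suc (dim U)" "S \<subseteq> B"
      using infinite_arbitrarily_large by blast
    moreover have "dim (S \<union> W) \<le> dim U"
      using \<open>S \<subseteq> B\<close> BU \<open>W \<subseteq> U\<close> by (intro dim_subset) auto
    ultimately show False using * by simp
  qed
  moreover have "span (B \<union> W) = U"
  proof
    show "span (B \<union> W) \<subseteq> U" using BU \<open>W \<subseteq> U\<close> U by (intro span_minimal) auto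
    show "U \<subseteq> span (B \<union> W)"
    proof
      fix u assume "u \<in> U"
      then obtain v where "v \<in> span B" "u - v \<in> W" using B by (auto simp: quotient_basis_def)
      then have "v \<in> span (B \<union> W)" "u - v \<in> span (B \<union> W)"
        using span_mono[of B "B \<union> W"] by (auto intro: span_base)
      then show "u \<in> span (B \<union> W)" using span_add by fastforce
    qed
  qed
  ultimately show ?thesis using *[of B] by (metis dim_span order_refl)
qed

lemma quotient_dim_add:
  assumes "subspace W" "subspace U" "W \<subseteq> U"
  shows "quotient_dim U W + dim W = dim U"
  using card_quotient_basis[OF assms] someI_ex[OF quotient_basis_exists[OF assms]]
  by (simp add: quotient_dim_def)

section \<open>Chains and flags as paths of a relation\<close>

definition maximal_pairs :: "('b set \<times> 'b set) set" where
  "maximal_pairs = {(N, M). maximal_subalgebra N M \<and> subalgebra M}"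

lemma subalgebra_subspace: "subalgebra M \<Longrightarrow> subspace M"
  by (simp add: subalgebra_def)

lemma ideal_subspace: "two_sided_ideal M \<Longrightarrow> subspace M"
  by (simp add: two_sided_ideal_def)

lemma idealD:
  assumes "two_sided_ideal I"
  shows "x \<in> I \<Longrightarrow> x \<bullet> y \<in> I" "x \<in> I \<Longrightarrow> y \<bullet> x \<in> I"
  using assms by (auto simp: two_sided_ideal_def)

lemma subalgebra_trivial [simp]: "subalgebra UNIV" "subalgebra {0}"
  by (auto simp: subalgebra_def)

lemma ideal_trivial [simp]: "two_sided_ideal UNIV" "two_sided_ideal {0}"
  by (auto simp: two_sided_ideal_def)

lemma maximal_pairsD:
  "(N, M) \<in> maximal_pairs \<Longrightarrow> subalgebra N \<and> subalgebra M \<and> N \<subset> M"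
  by (simp add: maximal_pairs_def maximal_subalgebra_def)

text \<open>As relational powers, chains can be spliced with \<open>relpow_trans\<close> and treated
  by induction at either end.\<close>

lemma maximal_chain_iff_relpow:
  "(\<exists>M. maximal_chain r M) \<longleftrightarrow> ({0}, UNIV) \<in> maximal_pairs ^^ r"
proof
  assume "\<exists>M. maximal_chain r M"
  then obtain M where M: "maximal_chain r M" ..
  have "(M i, M (Suc i)) \<in> maximal_pairs" if "i < r" for i
  proof -
    have "Suc i \<in> {1..r}" using that by auto
    then show ?thesis using M that unfolding maximal_chain_def maximal_pairs_def by force
  qed
  then show "({0}, UNIV) \<in> maximal_pairs ^^ r"
    using M unfolding relpow_fun_conv maximal_chain_def by blast
next
  assume "({0}, UNIV) \<in> maximal_pairs ^^ r"
  then obtain M where M: "M 0 = {0}" "M r = UNIV"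
    "\<And>i. i < r \<Longrightarrow> (M i, M (Suc i)) \<in> maximal_pairs"
    unfolding relpow_fun_conv by blast
  have "subalgebra (M j)" if "j \<le> r" for j
  proof (cases j)
    case (Suc i)
    then show ?thesis using M(3)[of i] that maximal_pairsD by auto
  qed (simp add: M)
  moreover have "maximal_subalgebra (M (j - 1)) (M j)" if "j \<in> {1..r}" for j
    using M(3)[of "j - 1"] that by (auto simp: maximal_pairs_def)
  ultimately have "maximal_chain r M" using M unfolding maximal_chain_def by blast
  then show "\<exists>M. maximal_chain r M" by blast
qed

text \<open>One step of a flag: for nested subspaces, dimensions differing by one express a
  one-dimensional quotient, so \<open>quotient_dim\<close> is eliminated by the next lemma.\<close>

abbreviation ideal_pairs :: "('b set \<times> 'b set) set" where
  "ideal_pairs \<equiv> {(I, J). two_sided_ideal I \<and> two_sided_ideal J \<and> I \<subseteq> J \<and> dim J = Suc (dim I)}"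

lemma supersolvable_iff_rtrancl:
  "supersolvable \<longleftrightarrow> ({0}, UNIV) \<in> ideal_pairs\<^sup>*"
proof
  assume supersolvable
  then obtain k :: nat and L where L: "L k = UNIV" "L 0 = {0}" "\<forall>j\<le>k. two_sided_ideal (L j)"
    "\<forall>j\<in>{1..k}. L (j - 1) \<subset> L j \<and> quotient_dim (L j) (L (j - 1)) = 1"
    unfolding supersolvable_def by blast
  have "(L i, L (Suc i)) \<in> ideal_pairs" if "i < k" for i
  proof -
    have "two_sided_ideal (L i)" "two_sided_ideal (L (Suc i))" using L(3) that by auto
    moreover have "Suc i \<in> {1..k}" using that by auto
    with L(4) have "L i \<subset> L (Suc i)" "quotient_dim (L (Suc i)) (L i) = 1" by fastforce+
    ultimately show ?thesis using quotient_dim_add[of "L i" "L (Suc i)"]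
      by (auto simp: ideal_subspace)
  qed
  then have "({0}, UNIV) \<in> ideal_pairs ^^ k" unfolding relpow_fun_conv using L(1,2) by blast
  then show "({0}, UNIV) \<in> ideal_pairs\<^sup>*" by (rule relpow_imp_rtrancl)
next
  assume "({0}, UNIV) \<in> ideal_pairs\<^sup>*"
  then obtain k where "({0}, UNIV) \<in> ideal_pairs ^^ k" using rtrancl_imp_relpow by blast
  then obtain L where L: "L 0 = {0}" "L k = UNIV" "\<And>i. i < k \<Longrightarrow> (L i, L (Suc i)) \<in> ideal_pairs"
    unfolding relpow_fun_conv by blast
  have "two_sided_ideal (L j)" if "j \<le> k" for j
  proof (cases j)
    case (Suc i)
    then show ?thesis using L(3)[of i] that by auto
  qed (simp add: L)
  moreover have "L (j - 1) \<subset> L j \<and> quotient_dim (L j) (L (j - 1)) = 1" if "j \<in> {1..k}" for j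
  proof -
    have "j - 1 < k" "Suc (j - 1) = j" using that by auto
    then show ?thesis
      using L(3)[of "j - 1"] quotient_dim_add[of "L (j - 1)" "L j"]
      by (auto simp: ideal_subspace)
  qed
  ultimately show supersolvable unfolding supersolvable_def using L(1,2)
    by (intro exI[of _ k] exI[of _ L]) simp
qed

section \<open>Existence and lengths of chains of subalgebras\<close>

lemma dim_relpow_maximal_pairs: "(U, V) \<in> maximal_pairs ^^ r \<Longrightarrow> dim U + r \<le> dim V"
proof (induction r arbitrary: V)
  case (Suc r)
  then obtain W where W: "(U, W) \<in> maximal_pairs ^^ r" "(W, V) \<in> maximal_pairs" by auto
  then have "dim W < dim V" by (intro dim_less) (auto dest: maximal_pairsD subalgebra_subspace)
  then show ?case using Suc.IH[OF W(1)] by simp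
qed simp

text \<open>A proper subalgebra of \<open>V\<close> of greatest dimension among those containing
  \<open>U\<close> is maximal in \<open>V\<close>; induction on the dimension of \<open>V\<close>
  continues below it.\<close>

lemma subalgebra_rtrancl_maximal_pairs:
  assumes "subalgebra U" "subalgebra V" "U \<subseteq> V"
  shows "(U, V) \<in> maximal_pairs\<^sup>*"
  using assms
proof (induction "dim V" arbitrary: V rule: less_induct)
  case less
  show ?case
  proof (cases "U = V")
    case False
    let ?P = "\<lambda>N. subalgebra N \<and> U \<subseteq> N \<and> N \<subset> V"
    have *: "dim N < dim V" if "subalgebra N" "N \<subset> V" for N
      using dim_less that less.prems by (auto simp: subalgebra_def)
    have "?P U" using False less.prems by blast
    moreover have "\<forall>N. ?P N \<longrightarrow> dim N < dim V" using * by blast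
    ultimately have "\<exists>N. ?P N \<and> (\<forall>K. ?P K \<longrightarrow> dim K \<le> dim N)"
      by (rule ex_has_greatest_nat[of ?P U dim])
    then obtain N where N: "subalgebra N" "U \<subseteq> N" "N \<subset> V"
      and max: "\<And>K. ?P K \<Longrightarrow> dim K \<le> dim N" by blast
    have "\<not> (\<exists>K. subalgebra K \<and> N \<subset> K \<and> K \<subset> V)"
    proof (rule notI, elim exE conjE)
      fix K assume K: "subalgebra K" "N \<subset> K" "K \<subset> V"
      then have "dim N < dim K" using N by (intro dim_less) (auto dest: subalgebra_subspace)
      moreover have "?P K" using K N by blast
      then have "dim K \<le> dim N" by (rule max)
      ultimately show False by simp
    qed
    then have "(N, V) \<in> maximal_pairs"
      using N less.prems(2) by (simp add: maximal_pairs_def maximal_subalgebra_def)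
    then show ?thesis using less.hyps[OF *[OF N(1,3)] less.prems(1) N(1,2)] by simp
  qed simp
qed

text \<open>Vectors are adjoined one at a time. A jump of one in dimension leaves no room for a
  subalgebra strictly between.\<close>

lemma relpow_maximal_pairs_if_all_subalgebras:
  assumes "subspace U" "subspace V" "U \<subseteq> V"
    and "\<And>S. subspace S \<Longrightarrow> U \<subseteq> S \<Longrightarrow> S \<subseteq> V \<Longrightarrow> subalgebra S"
  shows "(U, V) \<in> maximal_pairs ^^ (dim V - dim U)"
  using assms
proof (induction "dim V - dim U" arbitrary: U)
  case 0
  then have "U = V" by (intro subspace_dim_equal) auto
  then show ?case by simp
next
  case (Suc n)
  have "\<not> V \<subseteq> U" using Suc.hyps(2) dim_subset[of V U] by auto
  then obtain v where v: "v \<in> V" "v \<notin> U" by blast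
  let ?W = "span (insert v U)"
  have W: "dim ?W = Suc (dim U)" "?W \<subseteq> V" "U \<subseteq> ?W"
    using v Suc.prems(1-3) dim_span_insert[of U v] span_superset[of "insert v U"]
    by (blast, intro span_minimal, auto)
  have "(?W, V) \<in> maximal_pairs ^^ (dim V - dim ?W)"
    using Suc.hyps(2) W Suc.prems by (intro Suc.hyps(1)) auto
  moreover have "\<not> (\<exists>K. subalgebra K \<and> U \<subset> K \<and> K \<subset> ?W)"
  proof (rule notI, elim exE conjE)
    fix K assume K: "subalgebra K" "U \<subset> K" "K \<subset> ?W"
    have "dim U < dim K" "dim K < dim ?W"
      using dim_less[OF Suc.prems(1) _ K(2)] dim_less[OF _ _ K(3)] K(1)
      by (auto simp: subalgebra_subspace)
    then show False using W by simp
  qed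
  moreover have "v \<in> ?W" by (simp add: span_base)
  ultimately have "(U, V) \<in> maximal_pairs ^^ Suc (dim V - dim ?W)"
    using W v Suc.prems(1,4) Suc.prems(4)[of U] Suc.prems(3)
    by (intro relpow_Suc_I2[of U ?W]) (auto simp: maximal_pairs_def maximal_subalgebra_def)
  moreover have "Suc (dim V - dim ?W) = dim V - dim U" using Suc.hyps(2) W by simp
  ultimately show ?case by (simp only:)
qed

lemma subspace_derived_series [simp]: "subspace (derived_series i)"
  by (cases i) auto

lemma mult_in_derived_series_Suc:
  "x \<in> derived_series i \<Longrightarrow> y \<in> derived_series i \<Longrightarrow> x \<bullet> y \<in> derived_series (Suc i)"
  by (auto intro!: span_base)

lemma derived_series_Suc_subset: "derived_series (Suc i) \<subseteq> derived_series i"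
proof (induction i)
  case (Suc i)
  show ?case
    unfolding derived_series.simps(2)[of "Suc i"]
    by (intro span_minimal) (use Suc mult_in_derived_series_Suc in blast, simp)
qed simp

text \<open>A subspace between two consecutive derived terms contains all products of its elements,
  so it is a subalgebra. Each layer therefore has a chain of one-dimensional steps, and the layers
  are spliced.\<close>

lemma solvable_maximal_chain:
  assumes solvable
  shows "({0}, UNIV) \<in> maximal_pairs ^^ dim UNIV"
proof -
  have "(derived_series i, UNIV) \<in> maximal_pairs ^^ (dim UNIV - dim (derived_series i))" for i
  proof (induction i)
    case (Suc i)
    have "(derived_series (Suc i), derived_series i)
      \<in> maximal_pairs ^^ (dim (derived_series i) - dim (derived_series (Suc i)))"
    proof (rule relpow_maximal_pairs_if_all_subalgebras)
      fix S assume "subspace S" "derived_series (Suc i) \<subseteq> S" "S \<subseteq> derived_series i"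
      then show "subalgebra S" unfolding subalgebra_def
        using mult_in_derived_series_Suc by (meson subsetD)
    qed (rule subspace_derived_series derived_series_Suc_subset)+
    from relpow_trans[OF this Suc]
    show ?case
      using dim_subset[OF derived_series_Suc_subset[of i]] dim_subset[of "derived_series i" UNIV]
      by (simp del: derived_series.simps dim_UNIV)
  qed simp
  then show ?thesis using assms unfolding solvable_def
    by (metis dim_eq_0 diff_zero order_refl)
qed

section \<open>Codimension of maximal subalgebras\<close>

lemma dim_maximal_subalgebra_if_equal_lengths:
  assumes solvable and eq: "\<And>r r'. ({0}, UNIV) \<in> maximal_pairs ^^ r \<Longrightarrow>
      ({0}, UNIV) \<in> maximal_pairs ^^ r' \<Longrightarrow> r = r'"
    and MH: "(M, H) \<in> maximal_pairs"
  shows "dim H \<le> Suc (dim M)"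
proof -
  have sub: "subalgebra M" "subalgebra H" using maximal_pairsD[OF MH] by auto
  then have "({0}, M) \<in> maximal_pairs\<^sup>*" "(H, UNIV) \<in> maximal_pairs\<^sup>*"
    using subspace_0 by (auto intro!: subalgebra_rtrancl_maximal_pairs dest: subalgebra_subspace)
  then obtain a b where ab: "({0}, M) \<in> maximal_pairs ^^ a" "(H, UNIV) \<in> maximal_pairs ^^ b"
    by (meson rtrancl_imp_relpow)
  then have "({0}, UNIV) \<in> maximal_pairs ^^ (Suc a + b)"
    using MH by (meson relpow_Suc_I relpow_trans)
  \<comment> \<open>The chain through \<open>M\<close> and \<open>H\<close> is as long as the one
    from the derived series. As \<open>a\<close> is at most \<open>dim M\<close> and
    \<open>b\<close> at most \<open>dim UNIV - dim H\<close>, the step from \<open>M\<close> to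
    \<open>H\<close> has codimension at most one.\<close>
  then have "Suc a + b = dim UNIV" using solvable_maximal_chain[OF \<open>solvable\<close>] eq by blast
  then show ?thesis using ab[THEN dim_relpow_maximal_pairs] by simp
qed

text \<open>A vector \<open>v\<close> outside \<open>M\<close>, taken from the first flag member
  whose intersection with \<open>H\<close> leaves \<open>M\<close>, spans together with
  \<open>M\<close> a subalgebra of \<open>H\<close>; by maximality it is \<open>H\<close>.\<close>

lemma supersolvable_dim_maximal_subalgebra:
  assumes supersolvable and MH: "(M, H) \<in> maximal_pairs"
  shows "dim H = Suc (dim M)"
proof -
  have M: "subalgebra M" and H: "subalgebra H" and "M \<subset> H"
    using maximal_pairsD[OF MH] by auto
  note sub = M[THEN subalgebra_subspace] H[THEN subalgebra_subspace]
  have "({0}, UNIV) \<in> ideal_pairs\<^sup>*" using assms(1) supersolvable_iff_rtrancl by blast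
  \<comment> \<open>The second alternative carries the conclusion upwards once the escape has
    happened; at the top the first one contradicts \<open>M \<subset> H\<close>.\<close>
  moreover have "H \<inter> J \<subseteq> M \<or> dim H = Suc (dim M)" if "({0}, J) \<in> ideal_pairs\<^sup>*" for J
    using that
  proof (induction rule: rtrancl_induct)
    case base
    then show ?case using sub subspace_0 by auto
  next
    case (step I J)
    show ?case
    proof (cases "H \<inter> I \<subseteq> M \<and> \<not> H \<inter> J \<subseteq> M")
      case True
      then obtain v where v: "v \<in> H" "v \<in> J" "v \<notin> M" by blast
      have I: "subspace I" and J: "two_sided_ideal J" "subspace J"
        using step by (auto dest: ideal_subspace)
      have J_eq: "span (insert v I) = J"
        using step v True I J by (intro span_insert_eq_if_dim_le) auto
      let ?K = "span (insert v M)"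
      have KH: "?K \<subseteq> H" using v \<open>M \<subset> H\<close> sub by (intro span_minimal) auto
      \<comment> \<open>Modulo \<open>I\<close> an element of \<open>J\<close> is a multiple of
        \<open>v\<close>; the remainder lies in \<open>H \<inter> I\<close>, hence in
        \<open>M\<close>.\<close>
      have HJ: "H \<inter> J \<subseteq> ?K"
      proof
        fix x assume x: "x \<in> H \<inter> J"
        then obtain k where "x - scale k v \<in> I" using J_eq in_span_insert_iff[OF I] by blast
        moreover have "x - scale k v \<in> H" using x v sub by (auto intro: subspace_diff subspace_scale)
        ultimately show "x \<in> ?K" using True in_span_insert_iff[OF sub(1)] by blast
      qed
      have "subalgebra ?K"
        unfolding subalgebra_def
      proof safe
        fix x y assume xy: "x \<in> ?K" "y \<in> ?K"
        then obtain k l where kl: "x - scale k v \<in> M" "y - scale l v \<in> M"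
          using in_span_insert_iff[OF sub(1)] by blast
        then have "(x - scale k v) \<bullet> (y - scale l v) \<in> M"
          using M by (auto simp: subalgebra_def)
        then have "(x - scale k v) \<bullet> (y - scale l v) \<in> ?K" by (auto intro: span_base)
        moreover have "v \<bullet> y \<in> H" "(x - scale k v) \<bullet> v \<in> H"
          using H v xy kl KH \<open>M \<subset> H\<close> unfolding subalgebra_def by blast+
        then have "scale k v \<bullet> y \<in> H \<inter> J" "(x - scale k v) \<bullet> scale l v \<in> H \<inter> J"
          using idealD[OF J(1)] v sub(2) J(2)
          by (simp_all add: mult_scale_left mult_scale_right subspace_scale)
        \<comment> \<open>The terms with a factor \<open>v\<close> lie in
          \<open>H \<inter> J\<close>, hence in \<open>?K\<close>; the remaining product lies in
          \<open>M\<close>.\<close>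
        moreover have "x \<bullet> y = (x - scale k v) \<bullet> (y - scale l v) + (scale k v \<bullet> y + (x - scale k v) \<bullet> scale l v)"
          by (simp add: mult_diff_right mult_diff_left)
        ultimately show "x \<bullet> y \<in> ?K" using HJ span_add by (metis subsetD)
      qed
      moreover have "M \<subset> ?K" using v by (auto intro: span_base)
      ultimately have "\<not> ?K \<subset> H" using MH unfolding maximal_pairs_def maximal_subalgebra_def by blast
      then have "?K = H" using KH by blast
      then show ?thesis using dim_span_insert[OF sub(1) v(3)] by auto
    next
      case False
      then show ?thesis using step.IH by blast
    qed
  qed
  ultimately show ?thesis using \<open>M \<subset> H\<close> by blast
qed

lemma supersolvable_chain_length:
  assumes supersolvable
  shows "({0}, UNIV) \<in> maximal_pairs ^^ r \<Longrightarrow> r = dim UNIV"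
proof -
  have "(U, V) \<in> maximal_pairs ^^ r \<Longrightarrow> dim V = dim U + r" for U V
    by (induction r arbitrary: V) (auto dest: supersolvable_dim_maximal_subalgebra[OF assms])
  from this[of "{0}" UNIV] show "({0}, UNIV) \<in> maximal_pairs ^^ r \<Longrightarrow> r = dim UNIV"
    using dim_eq_0[of "{0}"] by simp
qed

section \<open>Supersolvable algebras are solvable\<close>

lemma ideal_one_dimensional_square:
  assumes I: "two_sided_ideal I" and J: "two_sided_ideal J" and "I \<subseteq> J" "dim J = Suc (dim I)"
    and xy: "x \<in> J" "y \<in> J"
  shows "x \<bullet> y \<in> I"
proof -
  note sub = I[THEN ideal_subspace] J[THEN ideal_subspace]
  obtain v where v: "v \<in> J" "v \<notin> I" using assms(3,4) by (metis n_not_Suc_n subsetI subset_antisym)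
  have J_eq: "span (insert v I) = J"
    using v assms sub by (intro span_insert_eq_if_dim_le) auto
  have IL: "a \<bullet> b \<in> I" "b \<bullet> a \<in> I" if "a \<in> I" for a b
    using I that by (auto simp: two_sided_ideal_def)
  have "v \<bullet> v \<in> J" using J v by (auto simp: two_sided_ideal_def)
  then obtain k where k: "v \<bullet> v - scale k v \<in> I" using J_eq in_span_insert_iff[OF sub(1)] by blast
  \<comment> \<open>Multiplying \<open>v \<bullet> v - scale k v\<close> on the right by
    \<open>v\<close> kills the square and leaves \<open>- scale k (v \<bullet> v)\<close>, which is
    in \<open>I\<close>; a nonzero \<open>k\<close> can be divided out.\<close>
  have vv: "v \<bullet> v \<in> I"
  proof (cases "k = 0")
    case False
    have "(v \<bullet> v - scale k v) \<bullet> v = - scale k (v \<bullet> v)"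
      by (simp add: mult_diff_left square_mult mult_scale_left)
    then have "- scale k (v \<bullet> v) \<in> I" using IL(1)[OF k, of v] by simp
    then have "scale (- inverse k) (- scale k (v \<bullet> v)) \<in> I" using sub by (blast intro: subspace_scale)
    then show ?thesis using False by simp
  qed (use k in simp)
  obtain l m where lm: "x - scale l v \<in> I" "y - scale m v \<in> I"
    using xy J_eq in_span_insert_iff[OF sub(1)] by blast
  have "x \<bullet> y = (x - scale l v) \<bullet> y + (scale l v \<bullet> (y - scale m v) + scale (l * m) (v \<bullet> v))"
    by (simp add: mult_diff_right mult_diff_left mult_scale_left mult_scale_right)
  then show ?thesis
    using IL lm vv sub by (auto intro!: subspace_add subspace_scale)
qed

text \<open>Descending the flag from the top: once a derived term lies in \<open>J\<close>, the next
  one lies in the flag member \<open>I\<close> just below, because products from \<open>J\<close>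
  fall into \<open>I\<close>.\<close>

lemma supersolvable_imp_solvable:
  assumes supersolvable
  shows solvable
proof -
  have "({0}, UNIV) \<in> ideal_pairs\<^sup>*" using assms supersolvable_iff_rtrancl by blast
  then have "\<exists>i. derived_series i \<subseteq> {0}"
  proof (induction rule: converse_rtrancl_induct)
    case base
    show ?case by auto
  next
    case (step I J)
    then obtain i where "derived_series i \<subseteq> J" by blast
    moreover have "subspace I" using step(1) by (simp add: ideal_subspace)
    ultimately have "derived_series (Suc i) \<subseteq> I"
      unfolding derived_series.simps
      using step(1) ideal_one_dimensional_square[of I J] \<open>derived_series i \<subseteq> J\<close>
      by (intro span_minimal) (auto simp: subset_iff)
    then show ?case by blast
  qed
  then show ?thesis unfolding solvable_def using subspace_0[OF subspace_derived_series] by blast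
qed

section \<open>Chief factors\<close>

lemma subspace_mult_preimage:
  assumes "subspace S"
  shows "subspace {x. y \<bullet> x \<in> S}" "subspace {x. x \<bullet> y \<in> S}"
  using assms unfolding subspace_def
  by (simp_all add: mult_add_left mult_add_right mult_scale_left mult_scale_right)

lemma ideal_spanI:
  assumes "\<And>x y. x \<in> S \<Longrightarrow> x \<bullet> y \<in> span S" "\<And>x y. x \<in> S \<Longrightarrow> y \<bullet> x \<in> span S"
  shows "two_sided_ideal (span S)"
proof -
  have "span S \<subseteq> {x. y \<bullet> x \<in> span S}" "span S \<subseteq> {x. x \<bullet> y \<in> span S}" for y
    using assms by (intro span_minimal subspace_mult_preimage subspace_span; blast)+
  then show ?thesis by (auto simp: two_sided_ideal_def)
qed

text \<open>\<open>J / I\<close> is a chief factor, that is, a minimal nonzero ideal of the quotient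
  algebra modulo \<open>I\<close>.\<close>

definition minimal_ideal_over :: "'b set \<Rightarrow> 'b set \<Rightarrow> bool" where
  "minimal_ideal_over I J \<longleftrightarrow> two_sided_ideal I \<and> two_sided_ideal J \<and> I \<subset> J \<and>
    (\<forall>K. two_sided_ideal K \<longrightarrow> I \<subseteq> K \<longrightarrow> K \<subseteq> J \<longrightarrow> K = I \<or> K = J)"

lemma minimal_ideal_over_exists:
  assumes "two_sided_ideal I" "I \<noteq> UNIV"
  shows "\<exists>J. minimal_ideal_over I J"
proof -
  let ?P = "\<lambda>J. two_sided_ideal J \<and> I \<subset> J"
  have "?P UNIV" using assms by auto
  then have "\<exists>J. ?P J \<and> (\<forall>K. ?P K \<longrightarrow> dim J \<le> dim K)" by (rule ex_has_least_nat)
  then obtain J where J: "two_sided_ideal J" "I \<subset> J" and min: "\<And>K. ?P K \<Longrightarrow> dim J \<le> dim K"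
    by blast
  have "K = I \<or> K = J" if K: "two_sided_ideal K" "I \<subseteq> K" "K \<subseteq> J" for K
  proof (cases "K = I")
    case False
    then have "dim J \<le> dim K" using K by (intro min) auto
    then show ?thesis using subspace_dim_equal[of K J] K J by (simp add: ideal_subspace)
  qed simp
  then show ?thesis using assms J unfolding minimal_ideal_over_def by blast
qed

text \<open>\<open>I\<close> and the products from \<open>J\<close> span an ideal between
  \<open>I\<close> and \<open>J\<close>. If it were \<open>J\<close>, then \<open>J\<close> would
  lie in the sum of \<open>I\<close> with every derived term, and solvability would put
  \<open>J\<close> inside \<open>I\<close>.\<close>

lemma minimal_ideal_over_abelian:
  assumes solvable and IJ: "minimal_ideal_over I J" and xy: "x \<in> J" "y \<in> J"
  shows "x \<bullet> y \<in> I"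
proof -
  have I: "two_sided_ideal I" and J: "two_sided_ideal J" and "I \<subset> J"
    using IJ by (auto simp: minimal_ideal_over_def)
  note sub = I[THEN ideal_subspace] J[THEN ideal_subspace]
  define P where "P = {x \<bullet> y |x y. x \<in> J \<and> y \<in> J}"
  let ?K = "span (I \<union> P)"
  have PK: "x \<bullet> y \<in> ?K" if "x \<in> J" "y \<in> J" for x y
    using that by (auto simp: P_def intro!: span_base)
  have "two_sided_ideal ?K"
  proof (rule ideal_spanI)
    fix g z assume g: "g \<in> I \<union> P"
    then consider "g \<in> I" | x y where "x \<in> J" "y \<in> J" "g = x \<bullet> y" by (auto simp: P_def)
    then have "g \<bullet> z \<in> ?K \<and> z \<bullet> g \<in> ?K"
    proof cases
      case 1
      then show ?thesis using idealD[OF I] by (auto intro: span_base)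
    next
      case 2
      have "g \<bullet> z \<in> ?K"
        unfolding 2(3) mult_mult_left using idealD[OF J] PK 2 by (intro span_diff) auto
      moreover have "z \<bullet> g \<in> ?K"
        unfolding 2(3) leibniz[of z x y] using idealD[OF J] PK 2 by (intro span_add) auto
      ultimately show ?thesis ..
    qed
    then show "g \<bullet> z \<in> ?K" "z \<bullet> g \<in> ?K" by auto
  qed
  moreover have "P \<subseteq> J" using idealD[OF J] by (auto simp: P_def)
  then have "?K \<subseteq> J" using \<open>I \<subset> J\<close> sub by (intro span_minimal) auto
  moreover have "I \<subseteq> ?K" by (auto intro: span_base)
  ultimately consider "?K = I" | "?K = J" using IJ unfolding minimal_ideal_over_def by blast
  then show ?thesis
  proof cases
    case 1
    then show ?thesis using PK xy by blast
  next
    case 2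
    \<comment> \<open>\<open>J\<close> is spanned by \<open>I\<close> and its own products.
      Splitting both factors into a part in \<open>I\<close> and a part in the current derived term
      moves each product to the next term modulo \<open>I\<close>.\<close>
    have "J \<subseteq> span (I \<union> derived_series i)" for i
    proof (induction i)
      case 0
      show ?case by (auto simp: Un_absorb1)
    next
      case (Suc i)
      let ?S = "span (I \<union> derived_series (Suc i))"
      have IS: "u \<in> ?S" if "u \<in> I" for u using that by (auto intro: span_base)
      have "P \<subseteq> ?S"
      proof
        fix p assume "p \<in> P"
        then obtain x y where p: "x \<in> J" "y \<in> J" "p = x \<bullet> y" by (auto simp: P_def)
        then obtain a d b e where ad: "a \<in> I" "d \<in> derived_series i" "x = a + d"
          and be: "b \<in> I" "e \<in> derived_series i" "y = b + e"
          using span_Un[of I "derived_series i"] Suc sub subspace_derived_series[of i]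
          by (smt (verit) mem_Collect_eq span_subspace_eq subsetD)
        have "d \<bullet> e \<in> ?S"
          using mult_in_derived_series_Suc[OF ad(2) be(2)] by (intro span_base UnI2)
        moreover have "a \<bullet> y \<in> ?S" "d \<bullet> b \<in> ?S" using ad be idealD[OF I] by (blast intro: IS)+
        ultimately have "a \<bullet> y + (d \<bullet> b + d \<bullet> e) \<in> ?S" by (intro span_add)
        also have "a \<bullet> y + (d \<bullet> b + d \<bullet> e) = p"
          by (simp add: p ad be mult_add_left mult_add_right algebra_simps)
        finally show "p \<in> ?S" .
      qed
      then have "?K \<subseteq> ?S" using IS by (intro span_minimal) (auto simp del: derived_series.simps)
      then show ?case using 2 by blast
    qed
    moreover obtain i where "derived_series i = {0}" using \<open>solvable\<close> unfolding solvable_def ..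
    ultimately have "J \<subseteq> span (I \<union> {0})" by metis
    moreover have "I \<union> {0} = I" using sub by (auto simp: subspace_0)
    ultimately show ?thesis using \<open>I \<subset> J\<close> sub by auto
  qed
qed

text \<open>The symmetrized products with elements of \<open>J\<close> generate over
  \<open>I\<close> an ideal whose left multiplications map everything into \<open>I\<close>. By
  minimality it is \<open>I\<close>, and right multiplication on \<open>J / I\<close> is minus the
  left one, or it is \<open>J\<close>, and products with left factor in \<open>J\<close> fall into
  \<open>I\<close>. Either way a left-invariant \<open>S\<close> is an ideal.\<close>

lemma minimal_ideal_over_left_irreducible:
  assumes IJ: "minimal_ideal_over I J" and S: "subspace S" "I \<subseteq> S" "S \<subseteq> J"
    and left: "\<And>x s. s \<in> S \<Longrightarrow> x \<bullet> s \<in> S"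
  shows "S = I \<or> S = J"
proof -
  have I: "two_sided_ideal I" and J: "two_sided_ideal J" and "I \<subset> J"
    using IJ by (auto simp: minimal_ideal_over_def)
  note sub = I[THEN ideal_subspace] J[THEN ideal_subspace]
  define P where "P = {x \<bullet> a + a \<bullet> x |x a. a \<in> J}"
  let ?K = "span (I \<union> P)"
  have PK: "x \<bullet> a + a \<bullet> x \<in> ?K" if "a \<in> J" for x a
    using that by (auto simp: P_def intro!: span_base)
  have right: "g \<bullet> z \<in> I" if "g \<in> I \<union> P" for g z
    using that idealD[OF I] symmetrized_mult subspace_0[OF sub(1)] by (auto simp: P_def)
  have "two_sided_ideal ?K"
  proof (rule ideal_spanI)
    fix g z assume g: "g \<in> I \<union> P"
    show "g \<bullet> z \<in> ?K" using right[OF g] by (auto intro: span_base)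
    from g consider "g \<in> I" | x a where "a \<in> J" "g = x \<bullet> a + a \<bullet> x" by (auto simp: P_def)
    then show "z \<bullet> g \<in> ?K"
    proof cases
      case 1
      then show ?thesis using idealD[OF I] by (auto intro: span_base)
    next
      case 2
      \<comment> \<open>Two Leibniz expansions, regrouped into symmetrized products of
        \<open>a\<close> and of \<open>z \<bullet> a\<close>.\<close>
      have "z \<bullet> g = ((z \<bullet> x) \<bullet> a + a \<bullet> (z \<bullet> x)) + (x \<bullet> (z \<bullet> a) + (z \<bullet> a) \<bullet> x)"
        using leibniz[of z x a] leibniz[of z a x] 2 by (simp add: mult_add_right algebra_simps)
      moreover have "z \<bullet> a \<in> J" using idealD[OF J] 2 by blast
      ultimately show ?thesis using PK 2(1) by (simp only: span_add)
    qed
  qed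
  moreover have "P \<subseteq> J" using idealD[OF J] sub by (auto simp: P_def intro!: subspace_add)
  then have "?K \<subseteq> J" using \<open>I \<subset> J\<close> sub by (intro span_minimal) auto
  moreover have IK: "I \<subseteq> ?K" by (auto intro: span_base)
  ultimately consider "?K = I" | "?K = J" using IJ unfolding minimal_ideal_over_def by blast
  then have "s \<bullet> x \<in> S" if "s \<in> S" for s x
  proof cases
    case 1
    then have "x \<bullet> s + s \<bullet> x \<in> S" using PK[of s x] that S by auto
    then have "(x \<bullet> s + s \<bullet> x) - x \<bullet> s \<in> S" using left[OF that] S(1) by (intro subspace_diff)
    then show ?thesis by simp
  next
    case 2
    have "?K \<subseteq> {g. g \<bullet> x \<in> I}"
      using right by (intro span_minimal subspace_mult_preimage sub) auto
    then show ?thesis using 2 that S by auto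
  qed
  then have "two_sided_ideal S" using S left by (auto simp: two_sided_ideal_def)
  then show ?thesis using IJ S unfolding minimal_ideal_over_def by blast
qed

text \<open>In \<open>mult_mult_left\<close> both terms fall into \<open>I\<close> as soon as one of
  the two left factors annihilates \<open>J\<close> modulo \<open>I\<close>.\<close>

lemma ideal_left_annihilator:
  assumes I: "two_sided_ideal I" and J: "two_sided_ideal J"
  shows "two_sided_ideal {x. \<forall>a\<in>J. x \<bullet> a \<in> I}"
proof -
  have "subspace {x. \<forall>a\<in>J. x \<bullet> a \<in> I}"
    using I[THEN ideal_subspace] unfolding subspace_def
    by (simp add: mult_add_left mult_scale_left)
  then show ?thesis
    unfolding two_sided_ideal_def mem_Collect_eq
    using idealD[OF I] idealD[OF J] I[THEN ideal_subspace]
    by (auto simp: mult_mult_left intro!: subspace_diff)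
qed

section \<open>Fitting decomposition for left multiplication by one element\<close>

lemma
  shows funpow_mult_diff: "((\<bullet>) n ^^ k) (x - y) = ((\<bullet>) n ^^ k) x - ((\<bullet>) n ^^ k) y"
    and funpow_mult_add: "((\<bullet>) n ^^ k) (x + y) = ((\<bullet>) n ^^ k) x + ((\<bullet>) n ^^ k) y"
    and funpow_mult_scale: "((\<bullet>) n ^^ k) (scale c x) = scale c (((\<bullet>) n ^^ k) x)"
    and funpow_mult_zero: "((\<bullet>) n ^^ k) 0 = 0"
  by (induction k) (simp_all add: mult_diff_right mult_add_right mult_scale_right)

text \<open>The ranges of the powers decrease, so from the one of least dimension on they are
  constant, and the \<open>k\<close>-th power of \<open>x\<close> is a \<open>(k + 2)\<close>-th
  power of some \<open>y\<close>. Two factors \<open>n\<close> are split off because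
  \<open>n \<bullet> (n \<bullet> y)\<close>, rather than \<open>n \<bullet> y\<close>, will lie in
  the annihilator of the chief factor.\<close>

lemma fitting:
  "\<exists>k. \<forall>x. \<exists>y. ((\<bullet>) n ^^ k) (x - n \<bullet> (n \<bullet> y)) = 0"
proof -
  let ?R = "\<lambda>k. range ((\<bullet>) n ^^ k)"
  have sub: "subspace (?R k)" for k
    unfolding subspace_def
    by (auto simp flip: funpow_mult_add funpow_mult_scale) (metis funpow_mult_zero rangeI)
  obtain k where k: "\<And>j. dim (?R k) \<le> dim (?R j)"
    using ex_has_least_nat[of "\<lambda>_. True" 0 "\<lambda>k. dim (?R k)"] by auto
  have eq: "((\<bullet>) n ^^ (k + 2)) y = ((\<bullet>) n ^^ k) (n \<bullet> (n \<bullet> y))" for y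
    by (simp add: funpow_swap1)
  have "?R (k + 2) = ?R k"
  proof (rule subspace_dim_equal)
    show "?R (k + 2) \<subseteq> ?R k" using eq by auto
  qed (rule sub k)+
  then have "\<exists>y. ((\<bullet>) n ^^ k) x = ((\<bullet>) n ^^ (k + 2)) y" for x
    by (metis rangeE rangeI)
  then show ?thesis using eq by (metis funpow_mult_diff cancel_comm_monoid_add_class.diff_cancel)
qed

text \<open>Left multiplication by \<open>n\<close> is a derivation, by the Leibniz identity, so its
  generalized null component modulo \<open>I\<close> is closed under products.\<close>

lemma subalgebra_null_component:
  assumes I: "two_sided_ideal I"
  shows "subalgebra {x. \<exists>k. ((\<bullet>) n ^^ k) x \<in> I}" (is "subalgebra ?N")
proof -
  note sub = I[THEN ideal_subspace]
  have stable: "((\<bullet>) n ^^ k) x \<in> I" if "x \<in> I" for x k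
    using that by (induction k) (auto intro: idealD[OF I])
  have mono: "((\<bullet>) n ^^ (l + k)) x \<in> I" if "((\<bullet>) n ^^ k) x \<in> I" for x k l
    using stable[OF that] by (simp add: funpow_add)
  have "x + y \<in> ?N" if "x \<in> ?N" "y \<in> ?N" for x y
  proof -
    from that obtain k l where "((\<bullet>) n ^^ k) x \<in> I" "((\<bullet>) n ^^ l) y \<in> I" by blast
    then have "((\<bullet>) n ^^ (l + k)) x \<in> I" "((\<bullet>) n ^^ (l + k)) y \<in> I"
      using mono[of k x l] mono[of l y k] by (simp_all add: add.commute)
    then have "((\<bullet>) n ^^ (l + k)) (x + y) \<in> I" using sub by (simp add: funpow_mult_add subspace_add)
    then show ?thesis by blast
  qed
  moreover have "0 \<in> ?N" using subspace_0[OF sub] by (auto intro!: exI[of _ 0])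
  moreover have "scale c x \<in> ?N" if "x \<in> ?N" for c x
    using that sub by (auto simp: funpow_mult_scale intro: subspace_scale)
  ultimately have "subspace ?N" unfolding subspace_def by blast
  \<comment> \<open>Induction on \<open>k + l\<close>: one application of \<open>n\<close> to the
    product gives two products, each with one exponent lowered. When an exponent reaches 0, that
    factor lies in \<open>I\<close>.\<close>
  moreover have "((\<bullet>) n ^^ (k + l)) (x \<bullet> y) \<in> I"
    if "((\<bullet>) n ^^ k) x \<in> I" "((\<bullet>) n ^^ l) y \<in> I" for x y k l
    using that
  proof (induction "k + l" arbitrary: k l x y)
    case 0
    then show ?case using idealD[OF I] by simp
  next
    case (Suc s)
    show ?case
    proof (cases "k = 0 \<or> l = 0")
      case True
      then have "x \<bullet> y \<in> I" using Suc.prems idealD[OF I] by auto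
      then show ?thesis by (rule stable)
    next
      case False
      then obtain k' l' where kl: "k = Suc k'" "l = Suc l'" by (metis not0_implies_Suc)
      have "((\<bullet>) n ^^ (k' + l)) ((n \<bullet> x) \<bullet> y) \<in> I" "((\<bullet>) n ^^ (k + l')) (x \<bullet> (n \<bullet> y)) \<in> I"
        using Suc.prems Suc.hyps(2) kl
        by (intro Suc.hyps(1); simp add: funpow_swap1)+
      moreover have "((\<bullet>) n ^^ (k + l)) (x \<bullet> y) = ((\<bullet>) n ^^ s) ((n \<bullet> x) \<bullet> y + x \<bullet> (n \<bullet> y))"
        using Suc.hyps(2)[symmetric] by (simp add: funpow_swap1 leibniz[of n x y])
      moreover have "k' + l = s" "k + l' = s" using kl Suc.hyps(2) by auto
      ultimately show ?thesis using sub by (simp add: funpow_mult_add subspace_add)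
    qed
  qed
  then have "\<forall>x\<in>?N. \<forall>y\<in>?N. x \<bullet> y \<in> ?N" by blast
  ultimately show ?thesis unfolding subalgebra_def by blast
qed

section \<open>Construction of the flag of ideals\<close>

lemma ideal_extension:
  assumes solvable and max: "\<And>M H. (M, H) \<in> maximal_pairs \<Longrightarrow> dim H \<le> Suc (dim M)"
    and "two_sided_ideal I" "I \<noteq> UNIV"
  shows "\<exists>J. two_sided_ideal J \<and> I \<subseteq> J \<and> dim J = Suc (dim I)"
  using assms(3,4)
proof (induction "dim UNIV - dim I" arbitrary: I rule: less_induct)
  case less
  note I = less.prems(1)
  obtain J where IJ: "minimal_ideal_over I J" using minimal_ideal_over_exists less.prems by blast
  then have J: "two_sided_ideal J" and "I \<subset> J" by (auto simp: minimal_ideal_over_def)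
  note sub = I[THEN ideal_subspace] J[THEN ideal_subspace]
  obtain a where a: "a \<in> J" "a \<notin> I" using \<open>I \<subset> J\<close> by blast
  define C where "C = {x. \<forall>a\<in>J. x \<bullet> a \<in> I}"
  have C: "two_sided_ideal C" unfolding C_def by (rule ideal_left_annihilator[OF I J])
  have "J \<subseteq> C" using minimal_ideal_over_abelian[OF \<open>solvable\<close> IJ] by (auto simp: C_def)
  \<comment> \<open>The minimal ideal \<open>J\<close> itself is the witness once one vector spans
    it over \<open>I\<close>.\<close>
  have "span (insert a I) = J"
  proof (cases "C = UNIV")
    case True
    let ?S = "span (insert a I)"
    \<comment> \<open>Everything acts as zero on \<open>J / I\<close> from the left, so the line of
      \<open>a\<close> modulo \<open>I\<close> is left-invariant.\<close>
    have "x \<bullet> s \<in> ?S" if "s \<in> ?S" for x s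
    proof -
      from that obtain k where k: "s - scale k a \<in> I" using in_span_insert_iff[OF sub(1)] by blast
      have "x \<bullet> a \<in> I" using True a(1) unfolding C_def by blast
      then have "x \<bullet> (s - scale k a) + scale k (x \<bullet> a) \<in> I"
        using idealD[OF I] k sub by (intro subspace_add subspace_scale) auto
      then show ?thesis by (simp add: mult_diff_right mult_scale_right span_base)
    qed
    moreover have "?S \<subseteq> J" using a \<open>I \<subset> J\<close> sub by (intro span_minimal) auto
    moreover have "I \<subseteq> ?S" "a \<in> ?S" by (auto intro: span_base)
    ultimately show ?thesis
      using minimal_ideal_over_left_irreducible[OF IJ subspace_span] a(2) by metis
  next
    case False
    \<comment> \<open>\<open>C\<close> contains \<open>J\<close>, so its codimension is smaller and
      the induction hypothesis applies to it.\<close>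
    have "I \<subset> C" using \<open>I \<subset> J\<close> \<open>J \<subseteq> C\<close> by blast
    then have "dim UNIV - dim C < dim UNIV - dim I"
      using dim_less[OF sub(1) ideal_subspace[OF C]] dim_subset[of C UNIV] by simp
    then obtain N where N: "two_sided_ideal N" "C \<subseteq> N" "dim N = Suc (dim C)"
      using less.hyps[of C] C False by blast
    then obtain n where n: "n \<in> N" "n \<notin> C" by (metis n_not_Suc_n subsetI subset_antisym)
    have N_eq: "span (insert n C) = N"
      using n N C by (intro span_insert_eq_if_dim_le) (auto simp: ideal_subspace)
    have in_N: "\<exists>k. x - scale k n \<in> C" if "x \<in> N" for x
      using that in_span_insert_iff[OF ideal_subspace[OF C]] N_eq by blast
    \<comment> \<open>The kernel of \<open>n\<close> on \<open>J / I\<close>. It is left-invariant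
      because \<open>n \<bullet> x\<close> is a multiple of \<open>n\<close> modulo
      \<open>C\<close>, and proper because \<open>n\<close> is not in \<open>C\<close>;
      irreducibility makes it zero.\<close>
    let ?S = "J \<inter> {b. n \<bullet> b \<in> I}"
    have "x \<bullet> b \<in> ?S" if b: "b \<in> ?S" for x b
    proof -
      obtain k where k: "n \<bullet> x - scale k n \<in> C" using in_N idealD[OF N(1)] n by blast
      have "(n \<bullet> x - scale k n) \<bullet> b + scale k (n \<bullet> b) + x \<bullet> (n \<bullet> b) \<in> I"
        using k b idealD[OF I] sub by (intro subspace_add subspace_scale) (auto simp: C_def)
      then have "n \<bullet> (x \<bullet> b) \<in> I"
        by (simp add: leibniz[of n x b] mult_diff_left mult_scale_left)
      then show ?thesis using b idealD[OF J] by blast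
    qed
    moreover have "subspace ?S" using sub by (intro subspace_inter subspace_mult_preimage)
    moreover have "I \<subseteq> ?S" using \<open>I \<subset> J\<close> idealD[OF I] by blast
    moreover have "?S \<noteq> J" using n(2) by (auto simp: C_def)
    ultimately have S: "?S = I"
      using minimal_ideal_over_left_irreducible[OF IJ, of ?S] by blast
    define L0 where "L0 = {x. \<exists>k. ((\<bullet>) n ^^ k) x \<in> I}"
    have L0: "subalgebra L0" unfolding L0_def by (rule subalgebra_null_component[OF I])
    note L0_sub = subalgebra_subspace[OF L0]
    have "I \<subseteq> L0" unfolding L0_def by (auto intro: exI[of _ 0])
    \<comment> \<open>Iterated injectivity: no power of \<open>n\<close> kills a nonzero element of
      \<open>J / I\<close>.\<close>
    have "b \<in> I" if "((\<bullet>) n ^^ k) b \<in> I" "b \<in> J" for k b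
      using that
    proof (induction k arbitrary: b)
      case (Suc k)
      then have "n \<bullet> b \<in> I" using idealD[OF J] by (simp add: funpow_swap1)
      then show ?case using S Suc.prems by blast
    qed simp
    then have L0_J: "L0 \<inter> J = I" using \<open>I \<subseteq> L0\<close> \<open>I \<subset> J\<close> unfolding L0_def by blast
    \<comment> \<open>\<open>L0\<close> supplements \<open>C\<close>: by \<open>fitting\<close>,
      \<open>x\<close> differs from an element of \<open>L0\<close> by
      \<open>n \<bullet> (n \<bullet> y)\<close>.\<close>
    have decomp: "\<exists>u\<in>L0. x - u \<in> C" for x
    proof -
      \<comment> \<open>\<open>n \<bullet> y\<close> is a multiple of \<open>n\<close> modulo the
        ideal \<open>C\<close>, and the square of \<open>n\<close> is in \<open>C\<close> by
        \<open>square_mult\<close>.\<close>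
      have nn: "n \<bullet> (n \<bullet> y) \<in> C" for y
      proof -
        obtain k where k: "n \<bullet> y - scale k n \<in> C" using in_N idealD[OF N(1)] n by blast
        have "n \<bullet> n \<in> C" using subspace_0[OF sub(1)] by (simp add: C_def square_mult)
        then have "n \<bullet> (n \<bullet> y - scale k n) + scale k (n \<bullet> n) \<in> C"
          using idealD[OF C] k ideal_subspace[OF C] by (intro subspace_add subspace_scale) auto
        then show ?thesis by (simp add: mult_diff_right mult_scale_right)
      qed
      obtain k y where "((\<bullet>) n ^^ k) (x - n \<bullet> (n \<bullet> y)) = 0" using fitting by metis
      then have "x - n \<bullet> (n \<bullet> y) \<in> L0" 
        unfolding L0_def using subspace_0[OF sub(1)] by (intro CollectI exI[of _ k]) simp
      moreover have "x - (x - n \<bullet> (n \<bullet> y)) \<in> C" using nn by simp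
      ultimately show ?thesis by blast
    qed
    let ?K = "span (L0 \<union> J)"
    have K_sum: "\<exists>u\<in>L0. x - u \<in> J" if "x \<in> ?K" for x
      using that L0_sub sub unfolding span_Un by force
    have "subalgebra ?K"
      unfolding subalgebra_def
    proof (intro conjI ballI)
      fix x y assume "x \<in> ?K" "y \<in> ?K"
      then obtain u v where uv: "u \<in> L0" "x - u \<in> J" "v \<in> L0" "y - v \<in> J" using K_sum by meson
      have "u \<bullet> v \<in> ?K" using uv L0 by (auto simp: subalgebra_def intro!: span_base)
      moreover have "(x - u) \<bullet> y \<in> ?K" "u \<bullet> (y - v) \<in> ?K"
        using uv idealD[OF J] by (auto intro!: span_base)
      ultimately have "(x - u) \<bullet> y + u \<bullet> (y - v) + u \<bullet> v \<in> ?K" by (intro span_add)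
      then show "x \<bullet> y \<in> ?K" by (simp add: mult_diff_left mult_diff_right)
    qed (rule subspace_span)
    have "L0 \<subseteq> ?K" "J \<subseteq> ?K" by (auto intro: span_base)
    have "a \<notin> L0" using a L0_J by blast
    have "\<not> (\<exists>R. subalgebra R \<and> L0 \<subset> R \<and> R \<subset> ?K)"
    proof (rule notI, elim exE conjE)
      fix R assume R: "subalgebra R" "L0 \<subset> R" "R \<subset> ?K"
      note R_sub = subalgebra_subspace[OF R(1)]
      \<comment> \<open>\<open>C\<close> maps \<open>J\<close> into \<open>I\<close>, hence into
        \<open>R\<close>, and \<open>R\<close> contains \<open>L0\<close>; together \<open>C\<close>
        and \<open>L0\<close> account for every \<open>x\<close>.\<close>
      have "x \<bullet> s \<in> R \<inter> J" if s: "s \<in> R \<inter> J" for x s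
      proof -
        obtain u where u: "u \<in> L0" "x - u \<in> C" using decomp by blast
        have "(x - u) \<bullet> s \<in> R" using u s \<open>I \<subseteq> L0\<close> R by (auto simp: C_def)
        moreover have "u \<bullet> s \<in> R" using u s R by (auto simp: subalgebra_def)
        ultimately have "(x - u) \<bullet> s + u \<bullet> s \<in> R" using R_sub by (intro subspace_add)
        then show ?thesis using s idealD[OF J] by (simp add: mult_diff_left)
      qed
      then have "R \<inter> J = I \<or> R \<inter> J = J"
        using R \<open>I \<subseteq> L0\<close> \<open>I \<subset> J\<close> R_sub sub
        by (intro minimal_ideal_over_left_irreducible[OF IJ] subspace_inter) auto
      then show False
      proof
        assume *: "R \<inter> J = I"
        \<comment> \<open>Modular law: \<open>R\<close> lies in \<open>L0 + J\<close>, and the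
          \<open>J\<close>-part of an element of \<open>R\<close> is in \<open>R \<inter> J\<close>,
          which here is \<open>I\<close>.\<close>
        have "R \<subseteq> L0"
        proof
          fix r assume r: "r \<in> R"
          then obtain u where u: "u \<in> L0" "r - u \<in> J" using K_sum R by blast
          then have "r - u \<in> R \<inter> J" using r R R_sub by (auto intro: subspace_diff)
          then have "(r - u) + u \<in> L0" using u * \<open>I \<subseteq> L0\<close> L0_sub by (intro subspace_add) auto
          then show "r \<in> L0" by simp
        qed
        then show False using R by blast
      next
        assume "R \<inter> J = J"
        then have "?K \<subseteq> R" using R R_sub by (intro span_minimal) auto
        then show False using R by blast
      qed
    qed
    then have "(L0, ?K) \<in> maximal_pairs"
      using L0 \<open>subalgebra ?K\<close> \<open>L0 \<subseteq> ?K\<close> \<open>J \<subseteq> ?K\<close> \<open>a \<notin> L0\<close> a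
      unfolding maximal_pairs_def maximal_subalgebra_def by blast
    then have "dim ?K \<le> Suc (dim L0)" by (rule max)
    then have "span (insert a L0) = ?K"
      using \<open>L0 \<subseteq> ?K\<close> \<open>J \<subseteq> ?K\<close> \<open>a \<notin> L0\<close> a L0_sub
      by (intro span_insert_eq_if_dim_le) auto
    \<comment> \<open>Codimension one of \<open>L0\<close> in \<open>?K\<close> passes to
      \<open>I\<close> in \<open>J\<close> on intersecting with \<open>J\<close>, since
      \<open>L0 \<inter> J = I\<close>.\<close>
    have "J \<subseteq> span (insert a I)"
    proof
      fix b assume b: "b \<in> J"
      then obtain k where "b - scale k a \<in> L0"
        using \<open>J \<subseteq> ?K\<close> \<open>span (insert a L0) = ?K\<close> in_span_insert_iff[OF L0_sub] by blast
      moreover have "b - scale k a \<in> J" using a b sub by (intro subspace_diff subspace_scale)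
      ultimately show "b \<in> span (insert a I)" using L0_J in_span_insert_iff[OF sub(1)] by blast
    qed
    moreover have "span (insert a I) \<subseteq> J" using a \<open>I \<subset> J\<close> sub by (intro span_minimal) auto
    ultimately show ?thesis by blast
  qed
  then have "dim J = Suc (dim I)" using dim_span_insert[OF sub(1) a(2)] by simp
  then show ?case using J \<open>I \<subset> J\<close> by blast
qed

text \<open>\<open>ideal_extension\<close> is iterated by induction on the codimension, and the flag
  starts at the zero ideal.\<close>

lemma supersolvable_if_equal_lengths:
  assumes solvable
    and eq: "\<And>r r'. ({0}, UNIV) \<in> maximal_pairs ^^ r \<Longrightarrow>
      ({0}, UNIV) \<in> maximal_pairs ^^ r' \<Longrightarrow> r = r'"
  shows supersolvable
proof -
  have "(I, UNIV) \<in> ideal_pairs\<^sup>*" if "two_sided_ideal I" for I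
    using that
  proof (induction "dim UNIV - dim I" arbitrary: I rule: less_induct)
    case less
    show ?case
    proof (cases "I = UNIV")
      case False
      then obtain J where J: "two_sided_ideal J" "I \<subseteq> J" "dim J = Suc (dim I)"
        using ideal_extension[OF \<open>solvable\<close> dim_maximal_subalgebra_if_equal_lengths] assms less.prems
        by blast
      then have "dim UNIV - dim J < dim UNIV - dim I" using dim_subset[of J UNIV] by simp
      then have "(J, UNIV) \<in> ideal_pairs\<^sup>*" using less.hyps J by blast
      moreover have "(I, J) \<in> ideal_pairs" using J less.prems by blast
      ultimately show ?thesis by (rule converse_rtrancl_into_rtrancl[rotated])
    qed simp
  qed
  then show ?thesis using supersolvable_iff_rtrancl ideal_trivial(2) by blast
qed

section \<open>The equivalence, first relative to a fixed basis\<close>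

theorem supersolvable_iff:
  "supersolvable \<longleftrightarrow> solvable \<and>
    (\<forall>r M r' M'. maximal_chain r M \<longrightarrow> maximal_chain r' M' \<longrightarrow> r = r')"
  using supersolvable_imp_solvable supersolvable_chain_length supersolvable_if_equal_lengths
    maximal_chain_iff_relpow
  by metis

end

theorem corollary5p3:
  fixes scale :: "'k::alg_closed_field \<Rightarrow> 'v::ab_group_add \<Rightarrow> 'v"
    and mult :: "'v \<Rightarrow> 'v \<Rightarrow> 'v"
  assumes "left_leibniz_algebra scale mult"
    and "left_leibniz_algebra.finite_dimensional scale"
  shows "left_leibniz_algebra.supersolvable scale mult \<longleftrightarrow>
    left_leibniz_algebra.solvable scale mult \<and>
    (\<forall>r M r' M'. left_leibniz_algebra.maximal_chain scale mult r M \<longrightarrow>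
       left_leibniz_algebra.maximal_chain scale mult r' M' \<longrightarrow> r = r')"
proof -
  interpret left_leibniz_algebra scale mult by fact
  obtain B where B: "finite B" "span B = UNIV"
    using assms(2) unfolding finite_dimensional_def by blast
  \<comment> \<open>The finite spanning set is thinned to a basis, which the finite-dimensional
    locale takes as a parameter.\<close>
  obtain Basis where Basis: "Basis \<subseteq> B" "independent Basis" "B \<subseteq> span Basis"
    using maximal_independent_subset[of B] by blast
  have "span Basis = UNIV" using B(2) span_minimal[OF Basis(3)] by auto
  then interpret finite_dimensional_leibniz_algebra scale mult Basis
    using B Basis finite_subset by unfold_locales auto
  show ?thesis by (rule supersolvable_iff)
qed

end
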